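(* Fix $1\leq p<\infty$. Any uniformly totally bounded collection $\mathcal{K}$ of compact $p$-metric spaces is pre-compact, i.e., any sequence in $\mathcal{K}$ has a subsequence which converges, with respect to $d_{\mathrm{GH}}^{(p)}$, to some compact $p$-metric space.
   Context: All metric spaces are nonempty. For $p\in[1,\infty)$, a $p$-metric space is a metric space satisfying $d(x,x'')^p\le d(x,x')^p+d(x',x'')^p$ for all points. For metric spaces $X,Y$, $$d_{\mathrm{GH}}^{(p)}(X,Y)=2^{-\frac1p}\inf_R\ \sup_{(x,y),(x',y')\in R}\left|d_X(x,x')^p-d_Y(y,y')^p\right|^{\frac1p},$$ with $R$ ranging over all correspondences between $X$ and $Y$ (subsets of $X\times Y$ projecting onto both factors). A class $\mathcal{K}$ of compact metric spaces is uniformly totally bounded if there exist a function $Q:(0,\infty)\to\mathbb{N}$ and $D>0$ such that every $X\in\mathcal{K}$ satisfies $\mathrm{diam}(X)\le D$ and, for every $\varepsilon>0$, $\mathrm{cov}_\varepsilon(X)\le Q(\varepsilon)$, where $\mathrm{cov}_\varepsilon(X)$ is the minimal cardinality of an $\varepsilon$-net of $X$ (a subset $S\subseteq X$ such that each $x\in X$ has some $s\in S$ with $d_X(x,s)\le\varepsilon$). *)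

theory Defs
  imports "HOL-Analysis.Analysis" "HOL-Library.Extended_Nat"
begin

text \<open>The library type \<^typ>\<open>'a metric\<close> admits an empty carrier; all metric spaces are
  nonempty here, so this is required explicitly.\<close>

definition compact_metric :: "'a metric \<Rightarrow> bool" where
  "compact_metric X \<longleftrightarrow> mspace X \<noteq> {} \<and> compact_space (mtopology_of X)"

definition p_metric :: "real \<Rightarrow> 'a metric \<Rightarrow> bool" where
  "p_metric p X \<longleftrightarrow>
     (\<forall>x\<in>mspace X. \<forall>x'\<in>mspace X. \<forall>x''\<in>mspace X.
        mdist X x x'' powr p \<le> mdist X x x' powr p + mdist X x' x'' powr p)"

definition correspondence :: "'a metric \<Rightarrow> 'b metric \<Rightarrow> ('a \<times> 'b) set \<Rightarrow> bool" where
  "correspondence X Y R \<longleftrightarrow>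
     R \<subseteq> mspace X \<times> mspace Y \<and> fst ` R = mspace X \<and> snd ` R = mspace Y"

text \<open>The distance takes values in the extended nonnegative reals, because the supremum may be
  infinite when the spaces are unbounded.\<close>

definition GH_dist :: "real \<Rightarrow> 'a metric \<Rightarrow> 'b metric \<Rightarrow> ennreal" where
  "GH_dist p X Y =
     ennreal (2 powr (- 1 / p)) *
     (INF R\<in>{R. correspondence X Y R}.
        SUP ((x, y), (x', y'))\<in>R \<times> R.
          ennreal (\<bar>mdist X x x' powr p - mdist Y y y' powr p\<bar> powr (1 / p)))"

definition metric_diam :: "'a metric \<Rightarrow> ennreal" where
  "metric_diam X = (SUP (x, x')\<in>mspace X \<times> mspace X. ennreal (mdist X x x'))"

definition is_net :: "real \<Rightarrow> 'a metric \<Rightarrow> 'a set \<Rightarrow> bool" where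
  "is_net \<epsilon> X S \<longleftrightarrow> S \<subseteq> mspace X \<and> (\<forall>x\<in>mspace X. \<exists>s\<in>S. mdist X x s \<le> \<epsilon>)"

text \<open>The infimum over finite nets is a minimum if there is one, and \<^term>\<open>\<infinity>\<close> otherwise.\<close>

definition cov :: "real \<Rightarrow> 'a metric \<Rightarrow> enat" where
  "cov \<epsilon> X = (INF S\<in>{S. finite S \<and> is_net \<epsilon> X S}. enat (card S))"

definition uniformly_totally_bounded :: "'a metric set \<Rightarrow> bool" where
  "uniformly_totally_bounded K \<longleftrightarrow>
     (\<exists>(Q :: real \<Rightarrow> nat) (D :: real). D > 0 \<and>
        (\<forall>X\<in>K. metric_diam X \<le> ennreal D \<and> (\<forall>\<epsilon>>0. cov \<epsilon> X \<le> enat (Q \<epsilon>))))"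

text \<open>Precompactness in the sense of sequences. The limit is sought among spaces whose points are
  real numbers: a compact metric space has at most continuum many points, so it is isometric to
  one of these, and isometric spaces are interchangeable for \<^const>\<open>GH_dist\<close>. The limit cannot
  in general be carried by the point type of the sequence, which may be countable.\<close>

definition GH_precompact :: "real \<Rightarrow> 'a metric set \<Rightarrow> bool" where
  "GH_precompact p K \<longleftrightarrow>
     (\<forall>X :: nat \<Rightarrow> 'a metric. (\<forall>n. X n \<in> K) \<longrightarrow>
        (\<exists>(r :: nat \<Rightarrow> nat) (Y :: real metric).
           strict_mono r \<and> compact_metric Y \<and> p_metric p Y \<and>
           (\<lambda>n. GH_dist p (X (r n)) Y) \<longlonglongrightarrow> 0))"

end

theory Submission
  imports Defs "HOL-Complex_Analysis.Great_Picard"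
begin

text \<open>Choose in every space a countable set of points whose prescribed finite parts are
  \<open>1 / (k + 1)\<close>-nets. Along a diagonal subsequence all distances between chosen points converge,
  and the limits form a totally bounded pseudometric on the natural numbers that inherits the
  \<open>p\<close>-triangle inequality. The Kuratowski embedding realises it by bounded functions; the closure
  of the image is compact and is the limit space, since points lying close to net points with the
  same index are in correspondence with small distortion.\<close>

section \<open>Carrying a compact metric over to real points\<close>

text \<open>The limit is first built from bounded functions on \<open>nat\<close>; this injection
  later turns them into real points. A sequence is determined by the rational cuts of its entries,
  which a single set of naturals encodes.\<close>

lemma ex_inj_real_sequences_real: "\<exists>\<phi> :: (nat \<Rightarrow> real) \<Rightarrow> real. inj \<phi>"
proof -
  define cut where "cut f = to_nat ` {(j, q :: rat). f j < of_rat q}" for f :: "nat \<Rightarrow> real"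
  have "inj cut"
  proof (rule injI, rule ext)
    fix f g :: "nat \<Rightarrow> real" and j
    assume "cut f = cut g"
    then have "{(j, q :: rat). f j < of_rat q} = {(j, q). g j < of_rat q}"
      unfolding cut_def by (simp add: inj_image_eq_iff)
    then have *: "f j < of_rat q \<longleftrightarrow> g j < of_rat q" for q
      by (auto simp: set_eq_iff)
    show "f j = g j"
    proof (rule ccontr)
      assume "f j \<noteq> g j"
      then consider "f j < g j" | "g j < f j" by linarith
      then show False
        by cases (metis * of_rat_dense less_asym)+
    qed
  qed
  moreover obtain h :: "nat set \<Rightarrow> real" where "inj h"
    using nat_sets_eqpoll_reals by (auto simp: eqpoll_def bij_betw_def)
  ultimately show ?thesis
    using inj_compose by blast
qed

text \<open>The metric is transported along \<open>\<phi>\<close>; the inverse \<open>g\<close>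
  becomes an isometry and pulls sequences back to \<open>C\<close>, where convergent subsequences
  exist.\<close>

lemma compact_isometric_copy:
  fixes C :: "'b::metric_space set" and \<phi> :: "'b \<Rightarrow> 'c"
  assumes "compact C" "C \<noteq> {}" "inj_on \<phi> C"
  obtains Y where "compact_metric Y" "mspace Y = \<phi> ` C"
    "\<And>u v. u \<in> C \<Longrightarrow> v \<in> C \<Longrightarrow> mdist Y (\<phi> u) (\<phi> v) = dist u v"
proof -
  define g where "g = inv_into C \<phi>"
  have g: "g (\<phi> u) = u" if "u \<in> C" for u
    using that assms(3) by (simp add: g_def)
  interpret Metric_space "\<phi> ` C" "\<lambda>a b. dist (g a) (g b)"
    by unfold_locales (auto simp: g dist_commute dist_triangle)
  have "compactin mtopology (\<phi> ` C)"
    unfolding compactin_sequentially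
  proof (intro conjI allI impI subset_refl)
    fix s :: "nat \<Rightarrow> 'c"
    assume s: "range s \<subseteq> \<phi> ` C"
    then have gs: "g (s n) \<in> C" "\<phi> (g (s n)) = s n" for n
      by (metis g image_iff range_subsetD)+
    obtain l r where l: "l \<in> C" "strict_mono r" "((g \<circ> s) \<circ> r) \<longlonglongrightarrow> l"
      using assms(1) gs unfolding compact_def by (metis comp_apply)
    have "limitin mtopology (s \<circ> r) (\<phi> l) sequentially"
      unfolding limitin_metric_dist_null
      using l s tendsto_dist_iff[of "(g \<circ> s) \<circ> r" l sequentially]
      by (auto simp: g intro!: always_eventually)
    then show "\<exists>l r. l \<in> \<phi> ` C \<and> strict_mono r \<and> limitin mtopology (s \<circ> r) l sequentially"
      using l by blast
  qed
  then have "compact_space (mtopology_of (metric (\<phi> ` C, \<lambda>a b. dist (g a) (g b))))"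
    by (simp add: compact_space_def)
  then show thesis
    using assms(2) by (intro that[of "metric (\<phi> ` C, \<lambda>a b. dist (g a) (g b))"])
      (auto simp: compact_metric_def g)
qed

section \<open>Embedding a pseudometric, and compactness of closures\<close>

text \<open>The map sends \<open>i\<close> to \<open>\<delta> i\<close>: by the triangle inequality
  \<open>\<delta> i k\<close> and \<open>\<delta> j k\<close> differ by at most
  \<open>\<delta> i j\<close>. Indices at distance 0 get the same image, so the pseudometric becomes
  a metric. On a discrete index type every bounded function is in \<open>bcontfun\<close>.\<close>

lemma kuratowski_embedding:
  fixes \<delta> :: "'i::discrete_topology \<Rightarrow> 'i \<Rightarrow> real"
  assumes "\<And>i. \<delta> i i = 0" "\<And>i j. \<delta> i j = \<delta> j i" "\<And>i j k. \<delta> i k \<le> \<delta> i j + \<delta> j k"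
    and "\<And>i j. \<delta> i j \<le> D"
  obtains F :: "'i \<Rightarrow> 'i \<Rightarrow>\<^sub>C real" where "\<And>i j. dist (F i) (F j) = \<delta> i j"
proof -
  have nonneg: "0 \<le> \<delta> i j" for i j
    using assms(1)[of i] assms(2)[of i j] assms(3)[of i i j] by linarith
  define F where "F i = Bcontfun (\<delta> i)" for i
  have "\<delta> i \<in> bcontfun" for i
    unfolding bcontfun_def bounded_iff
    using nonneg assms(4) by (auto intro!: exI[of _ D])
  then have F: "apply_bcontfun (F i) j = \<delta> i j" for i j
    by (simp add: F_def Bcontfun_inverse)
  have "dist (F i) (F j) = \<delta> i j" for i j
  proof (rule antisym)
    show "dist (F i) (F j) \<le> \<delta> i j"
    proof (rule dist_bound)
      fix k
      show "dist (F i k) (F j k) \<le> \<delta> i j"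
        using assms(3)[of i k j] assms(3)[of j k i] assms(2)[of i j]
        by (simp add: F dist_real_def)
    qed
    \<comment> \<open>The supremum is attained at the coordinate \<open>j\<close>, where
      \<open>F j\<close> vanishes.\<close>
    show "\<delta> i j \<le> dist (F i) (F j)"
      using dist_bounded[of "F i" j "F j"] nonneg[of i j] by (simp add: F dist_real_def assms(1))
  qed
  then show thesis by (rule that)
qed

text \<open>The instance of \<^class>\<open>complete_space\<close> in the library is restricted to metric domains, which
  excludes the discrete index type \<^typ>\<open>nat\<close>.\<close>

lemma complete_bcontfun:
  "complete (UNIV :: ('a::topological_space \<Rightarrow>\<^sub>C 'b::complete_space) set)"
proof (rule completeI)
  fix f :: "nat \<Rightarrow> 'a \<Rightarrow>\<^sub>C 'b"
  assume "Cauchy f"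
  then have "uniformly_Cauchy_on UNIV (\<lambda>n. apply_bcontfun (f n))"
    unfolding Cauchy_def uniformly_Cauchy_on_def by (meson dist_fun_lt_imp_dist_val_lt)
  then obtain g where "uniform_limit UNIV (\<lambda>n. apply_bcontfun (f n)) g sequentially"
    using Cauchy_uniformly_convergent unfolding uniformly_convergent_on_def by blast
  then obtain l where "f \<longlonglongrightarrow> l"
    by (rule uniform_limit_bcontfunE) auto
  then show "\<exists>l\<in>UNIV. f \<longlonglongrightarrow> l"
    by blast
qed

text \<open>A finite union of closed balls is closed, so it covers \<open>closure A\<close> as soon
  as it covers \<open>A\<close>; hence the closure is totally bounded, and it is complete as a
  closed set.\<close>

lemma compact_closure_if_finite_nets:
  fixes A :: "'b::metric_space set"
  assumes "complete (UNIV :: 'b set)"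
    and "\<And>e. e > 0 \<Longrightarrow> \<exists>N. finite N \<and> A \<subseteq> (\<Union>z\<in>N. cball z e)"
  shows "compact (closure A)"
  unfolding compact_eq_totally_bounded
proof (intro conjI allI impI)
  show "complete (closure A)"
    using assms(1) by (intro complete_closed_subset[OF closed_closure]) auto
  fix e :: real assume "e > 0"
  \<comment> \<open>Halving the radius leaves room to pass from closed balls to open balls of radius
    \<open>e\<close>.\<close>
  then obtain N where N: "finite N" "A \<subseteq> (\<Union>z\<in>N. cball z (e / 2))"
    using assms(2)[of "e / 2"] by auto
  then have "closure A \<subseteq> (\<Union>z\<in>N. cball z (e / 2))"
    by (intro closure_minimal closed_UN) auto
  also have "\<dots> \<subseteq> (\<Union>z\<in>N. ball z e)"
    using \<open>e > 0\<close> by (intro UN_mono) (auto simp: subset_iff)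
  finally show "\<exists>k. finite k \<and> closure A \<subseteq> (\<Union>x\<in>k. ball x e)"
    using N by blast
qed

section \<open>From close distances to small Gromov-Hausdorff distance\<close>

text \<open>Uniform continuity of \<open>a powr p\<close> on the compact interval
  \<open>{0..D}\<close>, with tolerance \<open>\<eta> powr p\<close> to absorb the outer root. The
  common diameter bound later supplies \<open>D\<close>.\<close>

lemma powr_distortion_small:
  fixes p D \<eta> :: real
  assumes "0 < p" "0 < \<eta>"
  obtains e where "0 < e"
    "\<And>a b. a \<in> {0..D} \<Longrightarrow> b \<in> {0..D} \<Longrightarrow> \<bar>a - b\<bar> < e \<Longrightarrow>
      \<bar>a powr p - b powr p\<bar> powr (1 / p) \<le> \<eta>"
proof -
  have "continuous_on {0..D} (\<lambda>a. a powr p)"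
    using assms(1) by (intro continuous_on_powr') (auto intro: continuous_intros)
  then have "uniformly_continuous_on {0..D} (\<lambda>a. a powr p)"
    by (rule compact_uniformly_continuous) simp
  then obtain e where "0 < e" and e: "\<And>a b. a \<in> {0..D} \<Longrightarrow> b \<in> {0..D} \<Longrightarrow> dist b a < e \<Longrightarrow>
      dist (b powr p) (a powr p) < \<eta> powr p"
    by (rule uniformly_continuous_onE[of _ _ "\<eta> powr p"]) (use assms(2) in auto)
  show thesis
  proof (rule that[OF \<open>0 < e\<close>])
    fix a b assume "a \<in> {0..D}" "b \<in> {0..D}" "\<bar>a - b\<bar> < e"
    then have "\<bar>a powr p - b powr p\<bar> powr (1 / p) \<le> (\<eta> powr p) powr (1 / p)"
      using assms(1) e[of b a] by (intro powr_mono2) (auto simp: dist_real_def)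
    then show "\<bar>a powr p - b powr p\<bar> powr (1 / p) \<le> \<eta>"
      using assms by (simp add: powr_powr)
  qed
qed

text \<open>A single correspondence bounds the infimum, and the factor
  \<open>2 powr (- 1 / p)\<close> is at most 1; this crude bound suffices for convergence to
  0.\<close>

lemma GH_dist_le:
  assumes "0 < p" "correspondence X Y R"
    and "\<And>x y x' y'. (x, y) \<in> R \<Longrightarrow> (x', y') \<in> R \<Longrightarrow>
      \<bar>mdist X x x' powr p - mdist Y y y' powr p\<bar> powr (1 / p) \<le> \<eta>"
  shows "GH_dist p X Y \<le> ennreal \<eta>"
proof -
  have "2 powr (- 1 / p) \<le> 2 powr (0 :: real)"
    using assms(1) by (intro powr_mono) auto
  then have "GH_dist p X Y \<le> ennreal 1 * ennreal \<eta>"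
    unfolding GH_dist_def using assms(2,3)
    by (intro mult_mono INF_lower2[of R] SUP_least) (auto intro!: ennreal_leI)
  then show ?thesis by simp
qed

lemma mdist_le_metric_diam:
  assumes "metric_diam X \<le> ennreal D" "0 \<le> D" "x \<in> mspace X" "y \<in> mspace X"
  shows "mdist X x y \<le> D"
proof -
  have "ennreal (mdist X x y) \<le> metric_diam X"
    unfolding metric_diam_def using assms(3,4) by (intro SUP_upper2[of "(x, y)"]) auto
  then show ?thesis
    using assms(1,2) by (meson ennreal_le_iff order_trans)
qed

section \<open>Nets indexed uniformly over the class\<close>

text \<open>Enumerating a smallest net lets \<open>{..<q}\<close> serve as index set for every space
  with the same covering bound.\<close>

lemma cov_le_enumeration:
  assumes "cov e X \<le> enat q" "mspace X \<noteq> {}"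
  obtains s :: "nat \<Rightarrow> 'a" where "range s \<subseteq> mspace X"
    "\<And>x. x \<in> mspace X \<Longrightarrow> \<exists>i<q. mdist X x (s i) \<le> e"
proof -
  let ?C = "(\<lambda>S. enat (card S)) ` {S. finite S \<and> is_net e X S}"
  \<comment> \<open>An empty family would have infimum \<open>\<infinity>\<close>, so a finite net
    exists; by well-ordering the infimum is then attained.\<close>
  have "cov e X \<noteq> \<infinity>"
    using assms(1) by (metis enat_ord_simps(5) enat.distinct(1))
  then have "?C \<noteq> {}"
    unfolding cov_def by (metis Inf_empty top_enat_def)
  then have "cov e X \<in> ?C"
    unfolding cov_def by (intro wellorder_InfI) (rule some_in_eq[THEN iffD2])
  then obtain S where S: "finite S" "is_net e X S" "cov e X = enat (card S)"
    by blast
  then have card: "card S \<le> q"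
    using assms(1) by simp
  obtain h where h: "bij_betw h {0..<card S} S"
    using ex_bij_betw_nat_finite[OF S(1)] by blast
  obtain x0 where x0: "x0 \<in> mspace X" using assms(2) by blast
  \<comment> \<open>Indices beyond the net are padded with \<open>x0\<close>, which keeps all values
    of \<open>s\<close> in the space.\<close>
  define s where "s i = (if i < card S then h i else x0)" for i
  show thesis
  proof (rule that[of s])
    show "range s \<subseteq> mspace X"
      using bij_betwE[OF h] x0 S(2) by (auto simp: s_def is_net_def)
    fix x assume "x \<in> mspace X"
    then obtain z where "z \<in> S" "mdist X x z \<le> e"
      using S(2) by (auto simp: is_net_def)
    moreover have "z \<in> h ` {0..<card S}"
      using bij_betw_imp_surj_on[OF h] \<open>z \<in> S\<close> by simp
    then obtain i where "i < card S" "h i = z"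
      by auto
    ultimately show "\<exists>i<q. mdist X x (s i) \<le> e"
      using card by (intro exI[of _ i]) (simp add: s_def)
  qed
qed

text \<open>Nets at all scales \<open>1 / (k + 1)\<close> are merged into one sequence per space.
  The index set \<open>I k\<close> is the same for all spaces in \<open>K\<close>, so their nets can
  be matched index by index.\<close>

lemma uniformly_totally_bounded_nets:
  assumes "uniformly_totally_bounded K" "\<And>X. X \<in> K \<Longrightarrow> mspace X \<noteq> {}"
  obtains I :: "nat \<Rightarrow> nat set" and x :: "'a metric \<Rightarrow> nat \<Rightarrow> 'a" and D :: real
  where "\<And>k. finite (I k)"
    "\<And>X i. X \<in> K \<Longrightarrow> x X i \<in> mspace X"
    "\<And>X k y. X \<in> K \<Longrightarrow> y \<in> mspace X \<Longrightarrow>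
      \<exists>i\<in>I k. mdist X y (x X i) \<le> inverse (real (Suc k))"
    "\<And>X y z. X \<in> K \<Longrightarrow> y \<in> mspace X \<Longrightarrow> z \<in> mspace X \<Longrightarrow> mdist X y z \<le> D"
proof -
  obtain Q D where D: "0 < D" "\<And>X. X \<in> K \<Longrightarrow> metric_diam X \<le> ennreal D"
    and Q: "\<And>X e. X \<in> K \<Longrightarrow> e > 0 \<Longrightarrow> cov e X \<le> enat (Q e)"
    using assms(1) unfolding uniformly_totally_bounded_def by blast
  let ?e = "\<lambda>k. inverse (real (Suc k))"
  have "\<exists>s. range s \<subseteq> mspace X \<and> (\<forall>y\<in>mspace X. \<exists>i<Q (?e k). mdist X y (s i) \<le> ?e k)"
    if "X \<in> K" for X k
  proof -
    have "cov (?e k) X \<le> enat (Q (?e k))"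
      by (rule Q[OF that]) simp
    then show ?thesis
      using assms(2)[OF that] by (rule cov_le_enumeration) blast
  qed
  then obtain s where s: "\<And>X k. X \<in> K \<Longrightarrow> range (s X k) \<subseteq> mspace X"
    "\<And>X k y. X \<in> K \<Longrightarrow> y \<in> mspace X \<Longrightarrow> \<exists>i<Q (?e k). mdist X y (s X k i) \<le> ?e k"
    by metis
  \<comment> \<open>The pairing function puts point \<open>i\<close> of the net at scale
    \<open>k\<close> at position \<open>prod_encode (k, i)\<close>.\<close>
  define x where "x X m = (case prod_decode m of (k, i) \<Rightarrow> s X k i)" for X m
  define I where "I k = (\<lambda>i. prod_encode (k, i)) ` {..<Q (?e k)}" for k
  show thesis
  proof (rule that[of I x D])
    show "x X i \<in> mspace X" if "X \<in> K" for X i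
      using s(1)[OF that] by (auto simp: x_def split: prod.split)
    show "\<exists>i\<in>I k. mdist X y (x X i) \<le> ?e k" if "X \<in> K" "y \<in> mspace X" for X k y
      using s(2)[OF that, of k] by (auto simp: I_def x_def)
    show "mdist X y z \<le> D" if "X \<in> K" "y \<in> mspace X" "z \<in> mspace X" for X y z
      using mdist_le_metric_diam[OF D(2)] D(1) that by simp
  qed (simp add: I_def)
qed

section \<open>Passing inequalities to limits\<close>

text \<open>Points of the closure are limits of points of \<open>range F\<close>, and both sides
  depend continuously on the distances, also at distance 0 because \<open>0 < p\<close>.\<close>

lemma powr_triangle_closure:
  fixes F :: "'i \<Rightarrow> 'b::metric_space"
  assumes "0 < p"
    and F: "\<And>i j k. dist (F i) (F k) powr p \<le> dist (F i) (F j) powr p + dist (F j) (F k) powr p"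
    and "u \<in> closure (range F)" "v \<in> closure (range F)" "w \<in> closure (range F)"
  shows "dist u w powr p \<le> dist u v powr p + dist v w powr p"
proof -
  obtain a b c where range: "\<And>n. a n \<in> range F" "\<And>n. b n \<in> range F" "\<And>n. c n \<in> range F"
    and lim: "a \<longlonglongrightarrow> u" "b \<longlonglongrightarrow> v" "c \<longlonglongrightarrow> w"
    using assms(3-5) unfolding closure_sequential by blast
  have "dist (a n) (c n) powr p \<le> dist (a n) (b n) powr p + dist (b n) (c n) powr p" for n
    using range[of n] F by auto
  moreover have "(\<lambda>n. dist (a n) (c n) powr p) \<longlonglongrightarrow> dist u w powr p"
    "(\<lambda>n. dist (a n) (b n) powr p + dist (b n) (c n) powr p) \<longlonglongrightarrow>
      dist u v powr p + dist v w powr p"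
    using assms(1) by (auto intro!: tendsto_add tendsto_powr2 tendsto_dist lim)
  ultimately show ?thesis
    by (intro LIMSEQ_le) auto
qed

lemma tendsto_0_if_eventually_le_ennreal:
  fixes f :: "'i \<Rightarrow> ennreal"
  assumes "\<And>\<eta>. 0 < \<eta> \<Longrightarrow> \<forall>\<^sub>F n in A. f n \<le> ennreal \<eta>"
  shows "(f \<longlongrightarrow> 0) A"
proof (rule order_tendstoI)
  fix c :: ennreal assume "0 < c"
  \<comment> \<open>Since \<open>c\<close> may be \<open>\<infinity>\<close>, a smaller positive
    \<open>b\<close> is taken, which is finite and thus comes from a positive real.\<close>
  then obtain b where b: "0 < b" "b < c"
    using dense by blast
  then have "b < top"
    by (meson order_less_le_trans top_greatest)
  with b(1) have "0 < enn2real b" "ennreal (enn2real b) = b"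
    by (auto simp: enn2real_positive_iff)
  with assms[of "enn2real b"] b(2) show "\<forall>\<^sub>F n in A. f n < c"
    by (auto elim: eventually_mono)
qed simp

section \<open>Convergence to the limit space\<close>

text \<open>Points are matched when they lie near net points with the same index. The distortion is
  then controlled by the distances within the nets, which converge uniformly because each
  \<open>I k\<close> is finite.\<close>

lemma GH_dist_tendsto_zero_if_nets_converge:
  fixes X :: "nat \<Rightarrow> 'a metric" and x :: "nat \<Rightarrow> nat \<Rightarrow> 'a" and F :: "nat \<Rightarrow> 'b::metric_space"
  assumes p: "0 < p"
    and x: "\<And>n i. x n i \<in> mspace (X n)"
    and I: "\<And>k. finite (I k)"
    and netX: "\<And>n k y. y \<in> mspace (X n) \<Longrightarrow>
      \<exists>i\<in>I k. mdist (X n) y (x n i) \<le> inverse (real (Suc k))"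
    and bdX: "\<And>n y z. y \<in> mspace (X n) \<Longrightarrow> z \<in> mspace (X n) \<Longrightarrow> mdist (X n) y z \<le> D"
    and lim: "\<And>i j. (\<lambda>n. mdist (X n) (x n i) (x n j)) \<longlonglongrightarrow> dist (F i) (F j)"
    and F: "\<And>i. F i \<in> C"
    and netC: "\<And>k u. u \<in> C \<Longrightarrow> \<exists>i\<in>I k. dist u (F i) \<le> inverse (real (Suc k))"
    and bdC: "\<And>u v. u \<in> C \<Longrightarrow> v \<in> C \<Longrightarrow> dist u v \<le> D"
    and Y: "mspace Y = \<phi> ` C" "\<And>u v. u \<in> C \<Longrightarrow> v \<in> C \<Longrightarrow> mdist Y (\<phi> u) (\<phi> v) = dist u v"
  shows "(\<lambda>n. GH_dist p (X n) Y) \<longlonglongrightarrow> 0"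
proof -
  have "\<forall>\<^sub>F n in sequentially. GH_dist p (X n) Y \<le> ennreal \<eta>" if "0 < \<eta>" for \<eta>
  proof -
    obtain e where e: "0 < e" "\<And>a b. a \<in> {0..D} \<Longrightarrow> b \<in> {0..D} \<Longrightarrow> \<bar>a - b\<bar> < e \<Longrightarrow>
      \<bar>a powr p - b powr p\<bar> powr (1 / p) \<le> \<eta>"
      using powr_distortion_small[OF p \<open>0 < \<eta>\<close>] by blast
    \<comment> \<open>Fifths of \<open>e\<close>: moving both endpoints to net points costs
      \<open>2 * c\<close> in each space, and the net distances differ by less than
      \<open>e / 5\<close>.\<close>
    obtain k where k: "inverse (real (Suc k)) < e / 5"
      using reals_Archimedean[of "e / 5"] \<open>0 < e\<close> by auto
    define c where "c = inverse (real (Suc k))"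
    have "0 \<le> c" by (simp add: c_def)
    have "\<forall>\<^sub>F n in sequentially. \<forall>i\<in>I k. \<forall>j\<in>I k.
        dist (mdist (X n) (x n i) (x n j)) (dist (F i) (F j)) < e / 5"
      using I lim \<open>0 < e\<close> by (intro eventually_ball_finite ballI tendstoD) auto
    then show ?thesis
    proof eventually_elim
      case (elim n)
      \<comment> \<open>Both projections are onto: a point \<open>y\<close> near
        \<open>x n i\<close> is matched with \<open>\<phi> (F i)\<close>, and
        \<open>\<phi> u\<close> with \<open>x n i\<close> when \<open>u\<close> is near
        \<open>F i\<close>.\<close>
      define R where "R = {(y, \<phi> u) | y u. y \<in> mspace (X n) \<and> u \<in> C \<and>
        (\<exists>i\<in>I k. mdist (X n) y (x n i) \<le> c \<and> dist u (F i) \<le> c)}"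
      have "\<exists>u\<in>C. \<exists>i\<in>I k. mdist (X n) y (x n i) \<le> c \<and> dist u (F i) \<le> c"
        if y: "y \<in> mspace (X n)" for y
      proof -
        obtain i where "i \<in> I k" "mdist (X n) y (x n i) \<le> c"
          using netX[OF y, of k] unfolding c_def by blast
        with F[of i] \<open>0 \<le> c\<close> show ?thesis
          by (intro bexI[of _ "F i"] bexI[of _ i]) auto
      qed
      moreover have "\<exists>y\<in>mspace (X n). \<exists>i\<in>I k. mdist (X n) y (x n i) \<le> c \<and> dist u (F i) \<le> c"
        if u: "u \<in> C" for u
      proof -
        obtain i where "i \<in> I k" "dist u (F i) \<le> c"
          using netC[OF u, of k] unfolding c_def by blast
        moreover have "mdist (X n) (x n i) (x n i) \<le> c"
          using \<open>0 \<le> c\<close> mdist_zero[OF x x, of n i i] by simp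
        ultimately show ?thesis
          using x[of n i] by blast
      qed
      ultimately have R: "correspondence (X n) Y R"
        unfolding correspondence_def Y(1) R_def by (auto simp: image_iff) blast+
      show "GH_dist p (X n) Y \<le> ennreal \<eta>"
      proof (rule GH_dist_le[OF p R])
        fix y a y' a'
        assume "(y, a) \<in> R" "(y', a') \<in> R"
        then obtain u i u' i' where *: "y \<in> mspace (X n)" "y' \<in> mspace (X n)"
          "a = \<phi> u" "a' = \<phi> u'" "u \<in> C" "u' \<in> C" "i \<in> I k" "i' \<in> I k"
          "mdist (X n) y (x n i) \<le> c" "dist u (F i) \<le> c"
          "mdist (X n) y' (x n i') \<le> c" "dist u' (F i') \<le> c"
          unfolding R_def by blast
        interpret M: Metric_space "mspace (X n)" "mdist (X n)" by simp
        have "\<bar>mdist (X n) y y' - mdist (X n) (x n i) (x n i')\<bar> \<le> 2 * c"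
          using M.triangle[of y "x n i" y'] M.triangle[of "x n i" "x n i'" y']
            M.triangle[of "x n i" y "x n i'"] M.triangle[of y y' "x n i'"]
            M.commute[of y "x n i"] M.commute[of y' "x n i'"] * x[of n i] x[of n i']
          by linarith
        moreover have "\<bar>dist u u' - dist (F i) (F i')\<bar> \<le> 2 * c"
          using * dist_triangle[of u u' "F i"] dist_triangle[of "F i" u' "F i'"]
            dist_triangle[of "F i" "F i'" u] dist_triangle[of u "F i'" u']
            dist_commute[of u "F i"] dist_commute[of u' "F i'"] by linarith
        moreover have "\<bar>mdist (X n) (x n i) (x n i') - dist (F i) (F i')\<bar> < e / 5"
          using elim * by (auto simp: dist_real_def)
        ultimately have "\<bar>mdist (X n) y y' - dist u u'\<bar> < e"
          using k unfolding c_def by linarith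
        then show "\<bar>mdist (X n) y y' powr p - mdist Y a a' powr p\<bar> powr (1 / p) \<le> \<eta>"
          using * bdX bdC Y(2) by (auto intro!: e(2))
      qed
    qed
  qed
  then show ?thesis
    by (rule tendsto_0_if_eventually_le_ennreal)
qed

text \<open>The limits \<open>\<delta>\<close> form a pseudometric on the indices. The closure of
  its Kuratowski image is compact because the finite nets survive the limit, and a copy of it with
  real points is the limit space.\<close>

lemma GH_convergent_if_net_distances_converge:
  fixes X :: "nat \<Rightarrow> 'a metric" and x :: "nat \<Rightarrow> nat \<Rightarrow> 'a"
  assumes p: "0 < p"
    and pX: "\<And>n. p_metric p (X n)"
    and x: "\<And>n i. x n i \<in> mspace (X n)"
    and I: "\<And>k. finite (I k)"
    and netX: "\<And>n k y. y \<in> mspace (X n) \<Longrightarrow>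
      \<exists>i\<in>I k. mdist (X n) y (x n i) \<le> inverse (real (Suc k))"
    and bdX: "\<And>n y z. y \<in> mspace (X n) \<Longrightarrow> z \<in> mspace (X n) \<Longrightarrow> mdist (X n) y z \<le> D"
    and lim: "\<And>i j. (\<lambda>n. mdist (X n) (x n i) (x n j)) \<longlonglongrightarrow> \<delta> i j"
  shows "\<exists>Y :: real metric. compact_metric Y \<and> p_metric p Y \<and> (\<lambda>n. GH_dist p (X n) Y) \<longlonglongrightarrow> 0"
proof -
  have zero: "\<delta> i i = 0" for i
  proof -
    have "mdist (X n) (x n i) (x n i) = 0" for n
      using x by simp
    then show ?thesis
      using lim[of i i] by (simp add: LIMSEQ_const_iff)
  qed
  have sym: "\<delta> i j = \<delta> j i" for i j
    by (rule LIMSEQ_unique[OF lim]) (subst mdist_commute, rule lim)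
  have tri: "\<delta> i k \<le> \<delta> i j + \<delta> j k" for i j k
    by (rule LIMSEQ_le[OF lim tendsto_add[OF lim lim]]) (intro exI allI impI mdist_triangle x)
  have bd: "\<delta> i j \<le> D" for i j
    by (rule LIMSEQ_le_const2[OF lim]) (intro exI allI impI bdX x)
  obtain F :: "nat \<Rightarrow> nat \<Rightarrow>\<^sub>C real" where F: "\<And>i j. dist (F i) (F j) = \<delta> i j"
    by (rule kuratowski_embedding[of \<delta> D, OF zero sym tri bd]) blast
  have limp: "(\<lambda>n. mdist (X n) (x n i) (x n j) powr p) \<longlonglongrightarrow> \<delta> i j powr p" for i j
    by (rule tendsto_powr2[OF lim tendsto_const]) (simp_all add: p)
  have ptri: "\<delta> i k powr p \<le> \<delta> i j powr p + \<delta> j k powr p" for i j k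
  proof (rule LIMSEQ_le[OF limp tendsto_add[OF limp limp]])
    show "\<exists>N. \<forall>n\<ge>N. mdist (X n) (x n i) (x n k) powr p \<le>
        mdist (X n) (x n i) (x n j) powr p + mdist (X n) (x n j) (x n k) powr p"
      using pX x by (simp add: p_metric_def)
  qed
  \<comment> \<open>The radius passes to the limit without loss: if every
    \<open>\<delta> j i\<close> exceeded it, then, \<open>I k\<close> being finite, in some
    \<open>X n\<close> all net points would be too far from \<open>x n j\<close>.\<close>
  have net: "\<exists>i\<in>I k. \<delta> j i \<le> inverse (real (Suc k))" for j k
  proof (rule ccontr)
    assume "\<not> (\<exists>i\<in>I k. \<delta> j i \<le> inverse (real (Suc k)))"
    then have "inverse (real (Suc k)) < \<delta> j i" if "i \<in> I k" for i
      using that by (meson not_le)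
    then have "\<forall>\<^sub>F n in sequentially. \<forall>i\<in>I k. inverse (real (Suc k)) < mdist (X n) (x n j) (x n i)"
      by (intro eventually_ball_finite[OF I] ballI order_tendstoD(1)[OF lim])
    then obtain n where "\<forall>i\<in>I k. inverse (real (Suc k)) < mdist (X n) (x n j) (x n i)"
      using eventually_happens'[OF sequentially_bot] by blast
    then show False
      using netX[OF x[of n j], of k] by (meson not_le)
  qed
  define C where "C = closure (range F)"
  have netC: "\<exists>i\<in>I k. dist u (F i) \<le> inverse (real (Suc k))" if "u \<in> C" for u k
  proof -
    \<comment> \<open>The union of closed balls is closed, so the net of \<open>range F\<close> is a
      net of \<open>C\<close> with the same radius.\<close>
    have "C \<subseteq> (\<Union>i\<in>I k. cball (F i) (inverse (real (Suc k))))"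
      unfolding C_def using net I F by (intro closure_minimal closed_UN) (auto simp: sym)
    with that show ?thesis
      unfolding subset_iff mem_cball UN_iff by (metis dist_commute)
  qed
  have FC: "F i \<in> C" for i
    using closure_subset[of "range F"] by (auto simp: C_def)
  have bdC: "dist u v \<le> D" if "u \<in> C" "v \<in> C" for u v
  proof -
    obtain a where a: "\<And>n. a n \<in> range F" "a \<longlonglongrightarrow> u"
      using \<open>u \<in> C\<close> unfolding C_def closure_sequential by blast
    obtain b where b: "\<And>n. b n \<in> range F" "b \<longlonglongrightarrow> v"
      using \<open>v \<in> C\<close> unfolding C_def closure_sequential by blast
    have "dist (a n) (b n) \<le> D" for n
      using a(1)[of n] b(1)[of n] bd F by auto
    then show ?thesis
      by (intro LIMSEQ_le_const2[OF tendsto_dist[OF a(2) b(2)]]) simp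
  qed
  have "compact C"
    unfolding C_def
  proof (rule compact_closure_if_finite_nets[OF complete_bcontfun])
    fix e :: real assume "e > 0"
    then obtain k where k: "inverse (real (Suc k)) < e"
      using reals_Archimedean by blast
    have "range F \<subseteq> (\<Union>z\<in>F ` I k. cball z e)"
    proof
      fix z assume "z \<in> range F"
      then have "z \<in> C"
        using FC by blast
      from netC[OF this, of k] obtain i where i: "i \<in> I k" "dist z (F i) \<le> inverse (real (Suc k))"
        by blast
      then have "z \<in> cball (F i) e"
        using k unfolding mem_cball dist_commute[of "F i"] by linarith
      with i(1) show "z \<in> (\<Union>z\<in>F ` I k. cball z e)"
        by blast
    qed
    with I show "\<exists>N. finite N \<and> range F \<subseteq> (\<Union>z\<in>N. cball z e)"
      by (meson finite_imageI)
  qed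
  obtain \<psi> :: "(nat \<Rightarrow> real) \<Rightarrow> real" where "inj \<psi>"
    using ex_inj_real_sequences_real by blast
  \<comment> \<open>A bounded function is read as a plain real sequence and then coded as one real;
    both maps are injective.\<close>
  define \<phi> where "\<phi> = (\<lambda>u :: nat \<Rightarrow>\<^sub>C real. \<psi> (apply_bcontfun u))"
  have "inj_on \<phi> C"
    by (rule inj_onI) (simp add: \<phi>_def inj_eq[OF \<open>inj \<psi>\<close>] apply_bcontfun_inject)
  moreover have "C \<noteq> {}"
    using FC by blast
  ultimately obtain Y where Y: "compact_metric Y" "mspace Y = \<phi> ` C"
    "\<And>u v. u \<in> C \<Longrightarrow> v \<in> C \<Longrightarrow> mdist Y (\<phi> u) (\<phi> v) = dist u v"
    using compact_isometric_copy[OF \<open>compact C\<close>] by blast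
  have "dist (F i) (F k) powr p \<le> dist (F i) (F j) powr p + dist (F j) (F k) powr p" for i j k
    using ptri F by simp
  then have "dist u w powr p \<le> dist u v powr p + dist v w powr p"
    if "u \<in> C" "v \<in> C" "w \<in> C" for u v w
    using that unfolding C_def by (rule powr_triangle_closure[OF p])
  then have "p_metric p Y"
    unfolding p_metric_def Y(2) by (simp add: Y(3))
  moreover have lim': "(\<lambda>n. mdist (X n) (x n i) (x n j)) \<longlonglongrightarrow> dist (F i) (F j)" for i j
    unfolding F by (rule lim)
  have "(\<lambda>n. GH_dist p (X n) Y) \<longlonglongrightarrow> 0"
    by (rule GH_dist_tendsto_zero_if_nets_converge[where X = X and x = x and I = I and D = D
          and F = F and C = C and \<phi> = \<phi>])
      (fact p x I netX bdX lim' FC netC bdC Y(2,3))+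
  ultimately show ?thesis
    using Y(1) by blast
qed

section \<open>The diagonal subsequence\<close>

theorem proposition7p9:
  fixes p :: real and K :: "'a metric set"
  assumes "1 \<le> p"
    and "\<And>X. X \<in> K \<Longrightarrow> compact_metric X"
    and "\<And>X. X \<in> K \<Longrightarrow> p_metric p X"
    and "uniformly_totally_bounded K"
  shows "GH_precompact p K"
  unfolding GH_precompact_def
proof (intro allI impI)
  fix X :: "nat \<Rightarrow> 'a metric"
  assume X: "\<forall>n. X n \<in> K"
  have "mspace Z \<noteq> {}" if "Z \<in> K" for Z
    using assms(2)[OF that] by (simp add: compact_metric_def)
  then obtain I :: "nat \<Rightarrow> nat set" and x :: "'a metric \<Rightarrow> nat \<Rightarrow> 'a" and D :: real
    where I: "\<And>k. finite (I k)"
      and x: "\<And>X i. X \<in> K \<Longrightarrow> x X i \<in> mspace X"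
      and net: "\<And>X k y. X \<in> K \<Longrightarrow> y \<in> mspace X \<Longrightarrow>
        \<exists>i\<in>I k. mdist X y (x X i) \<le> inverse (real (Suc k))"
      and bd: "\<And>X y z. X \<in> K \<Longrightarrow> y \<in> mspace X \<Longrightarrow> z \<in> mspace X \<Longrightarrow> mdist X y z \<le> D"
    by (rule uniformly_totally_bounded_nets[OF assms(4)]) blast+
  \<comment> \<open>Index pairs form one countable set and \<open>D\<close> bounds all values, so a
    single diagonal extraction makes all distances between chosen points converge.\<close>
  define f where "f n = (\<lambda>(i, j). mdist (X n) (x (X n) i) (x (X n) j))" for n
  have "norm (f n ij) \<le> D" for n ij
    using X x bd by (auto simp: f_def split: prod.split)
  then obtain r where r: "strict_mono r" "\<And>ij. \<exists>l. (\<lambda>n. f (r n) ij) \<longlonglongrightarrow> l"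
    using function_convergent_subsequence[of UNIV f D] by (metis UNIV_I countableI_type)
  then obtain l where "\<And>ij. (\<lambda>n. f (r n) ij) \<longlonglongrightarrow> l ij"
    by metis
  from this[of "(i, j)" for i j]
  have l: "(\<lambda>n. mdist (X (r n)) (x (X (r n)) i) (x (X (r n)) j)) \<longlonglongrightarrow> l (i, j)" for i j
    by (simp add: f_def)
  have "\<exists>Y :: real metric. compact_metric Y \<and> p_metric p Y \<and>
      (\<lambda>n. GH_dist p (X (r n)) Y) \<longlonglongrightarrow> 0"
  proof (rule GH_convergent_if_net_distances_converge[where x = "\<lambda>n. x (X (r n))" and I = I
        and D = D and \<delta> = "\<lambda>i j. l (i, j)"])
    show "0 < p"
      using assms(1) by simp
    have "X (r n) \<in> K" for n
      using X by blast
    note net[OF this] bd[OF this] x[OF this] assms(3)[OF this]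
    then show "p_metric p (X (r n))" "x (X (r n)) i \<in> mspace (X (r n))"
      "y \<in> mspace (X (r n)) \<Longrightarrow> \<exists>i\<in>I k. mdist (X (r n)) y (x (X (r n)) i) \<le> inverse (real (Suc k))"
      "y \<in> mspace (X (r n)) \<Longrightarrow> z \<in> mspace (X (r n)) \<Longrightarrow> mdist (X (r n)) y z \<le> D" for n i k y z
      by blast+
  qed (fact I l)+
  with r(1) show "\<exists>r (Y :: real metric). strict_mono r \<and> compact_metric Y \<and> p_metric p Y \<and>
      (\<lambda>n. GH_dist p (X (r n)) Y) \<longlonglongrightarrow> 0"
    by blast
qed

end
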